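(* Let $k$ be a field of characteristic not equal to $2$, and let $L$ be an $n$-dimensional nilpotent Lie algebra of maximal class over $k$. Then $\dim \mathcal{M}(L)\leq n/2$ when $n$ is even, and $\dim \mathcal{M}(L)\leq \lceil (n+1)/2\rceil$ when $n$ is odd.
   Context: For a Lie algebra $L$ over a field $k$, the lower central series is $\gamma_1(L)=L$, $\gamma_{i+1}(L)=[\gamma_i(L),L]$, and $L^2=\gamma_2(L)=[L,L]$. $L$ is nilpotent of class $c$ if $\gamma_{c+1}(L)=0$ and $\gamma_c(L)\neq 0$. An $n$-dimensional nilpotent Lie algebra $L$ is of maximal class if its nilpotency class is $c=n-1$; equivalently $\dim L/\gamma_2(L)=2$ and $\dim \gamma_i(L)/\gamma_{i+1}(L)=1$ for all $2\le i\le c$ (so $\dim L^2=n-2$). The Schur multiplier of $L$ is $\mathcal{M}(L)=(R\cap [F,F])/[R,F]$, where $L\cong F/R$ is a free presentation of $L$ ($F$ a free Lie algebra over $k$, $R$ an ideal of $F$); up to isomorphism this does not depend on the presentation. All dimensions are over $k$. *)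

theory Defs
  imports Complex_Main
begin

section \<open>Dimension of a quotient of subspaces\<close>

context vector_space
begin

text \<open>
  For subspaces B and A with B contained in A, a basis of the quotient A / B is given through a set C
  of representatives: the cosets of the elements of C are pairwise distinct, linearly independent
  and span A / B.
\<close>

definition quot_independent :: "'b set \<Rightarrow> 'b set \<Rightarrow> bool" where
  "quot_independent B C \<longleftrightarrow>
     (\<forall>T u. finite T \<longrightarrow> T \<subseteq> C \<longrightarrow> (\<Sum>v\<in>T. scale (u v) v) \<in> B \<longrightarrow> (\<forall>v\<in>T. u v = 0))"

definition quot_basis :: "'b set \<Rightarrow> 'b set \<Rightarrow> 'b set \<Rightarrow> bool" where
  "quot_basis A B C \<longleftrightarrow> C \<subseteq> A \<and> local.quot_independent B C \<and> A \<subseteq> local.span (B \<union> C)"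

definition fin_dim_quot :: "'b set \<Rightarrow> 'b set \<Rightarrow> bool" where
  "fin_dim_quot A B \<longleftrightarrow> (\<exists>C. finite C \<and> local.quot_basis A B C)"

text \<open>As with \<^term>\<open>local.dim\<close>, the value is only meaningful in the finite-dimensional case.\<close>

definition quot_dim :: "'b set \<Rightarrow> 'b set \<Rightarrow> nat" where
  "quot_dim A B = card (SOME C. local.quot_basis A B C)"

text \<open>Agreement with \<^term>\<open>local.dim\<close> on every realisation of A / B as the image of a linear map.\<close>

lemma quot_basis_linear_image:
  assumes "Vector_Spaces.linear scale s2 q" and ker: "{x \<in> A. q x = 0} = B"
    and A: "local.subspace A" and C: "local.quot_basis A B C"
  shows "inj_on q C" and "\<not> module.dependent s2 (q ` C)" and "module.span s2 (q ` C) = q ` A"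
proof -
  interpret q: Vector_Spaces.linear scale s2 q by fact
  have CA: "C \<subseteq> A" and ind: "local.quot_independent B C" and sp: "A \<subseteq> local.span (B \<union> C)"
    using C by (auto simp: quot_basis_def)
  have BA: "B \<subseteq> A" using ker by blast
  have key: "\<forall>v\<in>T. u v = 0"
    if T: "finite T" "T \<subseteq> C" "(\<Sum>v\<in>T. s2 (u v) (q v)) = 0" for T u
  proof -
    have "(\<Sum>v\<in>T. scale (u v) v) \<in> A"
      using T CA A by (intro subspace_sum subspace_scale) auto
    moreover have "q (\<Sum>v\<in>T. scale (u v) v) = 0"
      using T(3) by (simp add: q.sum q.scale)
    ultimately show ?thesis
      using ker ind T unfolding quot_independent_def by blast
  qed
  show inj: "inj_on q C"
  proof (rule inj_onI, rule ccontr)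
    fix x y assume xy: "x \<in> C" "y \<in> C" "q x = q y" "x \<noteq> y"
    have "\<forall>v\<in>{x, y}. (if v = x then 1 else - 1 :: 'a) = 0"
      by (rule key) (use xy in auto)
    then show False by simp
  qed
  show "\<not> module.dependent s2 (q ` C)"
  proof
    assume "module.dependent s2 (q ` C)"
    then obtain S u where S: "finite S" "S \<subseteq> q ` C" "(\<Sum>v\<in>S. s2 (u v) v) = 0" "\<exists>v\<in>S. u v \<noteq> 0"
      unfolding q.vs2.dependent_explicit by blast
    obtain T where T: "finite T" "T \<subseteq> C" "S = q ` T"
      using finite_subset_image[OF S(1,2)] by blast
    have "\<forall>v\<in>T. u (q v) = 0"
      by (rule key) (use T S(3) inj in \<open>auto simp: sum.reindex inj_on_subset\<close>)
    with S(4) T(3) show False by blast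
  qed
  have "local.span (B \<union> C) = A"
    using sp A BA CA by (intro equalityI span_minimal) auto
  then have "q ` A = q.vs2.span (q ` B \<union> q ` C)"
    by (metis q.span_image image_Un)
  also have "\<dots> = q.vs2.span (q ` C)"
  proof (rule q.vs2.span_eq[THEN iffD2], intro conjI)
    show "q ` B \<union> q ` C \<subseteq> q.vs2.span (q ` C)"
      using ker by (auto intro: q.vs2.span_zero q.vs2.span_base)
    show "q ` C \<subseteq> q.vs2.span (q ` B \<union> q ` C)"
      by (auto intro: q.vs2.span_base)
  qed
  finally show "module.span s2 (q ` C) = q ` A" by simp
qed

lemma quot_dim_linear_image:
  assumes "Vector_Spaces.linear scale s2 q" and "{x \<in> A. q x = 0} = B"
    and "local.subspace A" and "local.fin_dim_quot A B"
  shows "local.quot_dim A B = vector_space.dim s2 (q ` A)"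
proof -
  interpret q: Vector_Spaces.linear scale s2 q by fact
  define C where "C = (SOME C. local.quot_basis A B C)"
  have "local.quot_basis A B C"
    using assms(4) unfolding fin_dim_quot_def C_def by (metis someI_ex)
  note C = quot_basis_linear_image[OF assms(1-3) this]
  have "q.vs2.dim (q ` A) = card (q ` C)"
    using q.vs2.dim_span_eq_card_independent[OF C(2)] C(3) by simp
  then show ?thesis
    using card_image[OF C(1)] by (simp add: quot_dim_def C_def)
qed

end

section \<open>Lie algebras\<close>

locale lie_algebra = vector_space scale
  for scale :: "'k::field \<Rightarrow> 'l::ab_group_add \<Rightarrow> 'l" +
  fixes bracket :: "'l \<Rightarrow> 'l \<Rightarrow> 'l"
  assumes bracket_add_left: "bracket (x + y) z = bracket x z + bracket y z"
    and bracket_add_right: "bracket x (y + z) = bracket x y + bracket x z"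
    and bracket_scale_left: "bracket (scale a x) y = scale a (bracket x y)"
    and bracket_scale_right: "bracket x (scale a y) = scale a (bracket x y)"
    and bracket_self: "bracket x x = 0"
    and jacobi: "bracket x (bracket y z) + bracket y (bracket z x) + bracket z (bracket x y) = 0"
begin

definition commutator :: "'l set \<Rightarrow> 'l set \<Rightarrow> 'l set" where
  "commutator A B = local.span {bracket a b |a b. a \<in> A \<and> b \<in> B}"

text \<open>The lower central series is indexed from 1; the value at 0 is a dummy.\<close>

fun lower_central :: "nat \<Rightarrow> 'l set" where
  "lower_central 0 = UNIV"
| "lower_central (Suc 0) = UNIV"
| "lower_central (Suc (Suc i)) = commutator (lower_central (Suc i)) UNIV"

definition nilpotent_of_class :: "nat \<Rightarrow> bool" where
  "nilpotent_of_class c \<longleftrightarrow> c \<ge> 1 \<and> lower_central (c + 1) = {0} \<and> lower_central c \<noteq> {0}"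

definition has_dimension :: "nat \<Rightarrow> bool" where
  "has_dimension n \<longleftrightarrow> (\<exists>B. finite_dimensional_vector_space scale B) \<and> local.dim UNIV = n"

text \<open>Written with c + 1 = n instead of c = n - 1 to avoid truncated subtraction.\<close>

definition maximal_class :: "nat \<Rightarrow> bool" where
  "maximal_class n \<longleftrightarrow> has_dimension n \<and> (\<exists>c. nilpotent_of_class c \<and> c + 1 = n)"

end

definition lie_hom ::
  "('k::field \<Rightarrow> 'a::ab_group_add \<Rightarrow> 'a) \<Rightarrow> ('a \<Rightarrow> 'a \<Rightarrow> 'a) \<Rightarrow>
   ('k \<Rightarrow> 'b::ab_group_add \<Rightarrow> 'b) \<Rightarrow> ('b \<Rightarrow> 'b \<Rightarrow> 'b) \<Rightarrow> ('a \<Rightarrow> 'b) \<Rightarrow> bool" where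
  "lie_hom s1 b1 s2 b2 f \<longleftrightarrow> Vector_Spaces.linear s1 s2 f \<and> (\<forall>x y. f (b1 x y) = b2 (f x) (f y))"

section \<open>Free Lie algebras\<close>

text \<open>
  The free Lie algebra over the field 'k on the set of generators 'x, as the algebra of formal
  expressions modulo the congruence generated by the axioms of Lie algebras.
\<close>

datatype ('k, 'x) lie_term =
    TGen 'x
  | TZero
  | TAdd "('k, 'x) lie_term" "('k, 'x) lie_term"
  | TScale 'k "('k, 'x) lie_term"
  | TBr "('k, 'x) lie_term" "('k, 'x) lie_term"

inductive lie_eq :: "('k::field, 'x) lie_term \<Rightarrow> ('k, 'x) lie_term \<Rightarrow> bool" where
  refl: "lie_eq s s"
| sym: "lie_eq s t \<Longrightarrow> lie_eq t s"
| trans: "lie_eq s t \<Longrightarrow> lie_eq t u \<Longrightarrow> lie_eq s u"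
| cong_add: "lie_eq s s' \<Longrightarrow> lie_eq t t' \<Longrightarrow> lie_eq (TAdd s t) (TAdd s' t')"
| cong_scale: "lie_eq s s' \<Longrightarrow> lie_eq (TScale a s) (TScale a s')"
| cong_br: "lie_eq s s' \<Longrightarrow> lie_eq t t' \<Longrightarrow> lie_eq (TBr s t) (TBr s' t')"
| add_assoc: "lie_eq (TAdd (TAdd s t) u) (TAdd s (TAdd t u))"
| add_comm: "lie_eq (TAdd s t) (TAdd t s)"
| add_zero: "lie_eq (TAdd TZero s) s"
| add_inv: "lie_eq (TAdd (TScale (- 1) s) s) TZero"
| scale_add: "lie_eq (TScale a (TAdd s t)) (TAdd (TScale a s) (TScale a t))"
| add_scale: "lie_eq (TScale (a + b) s) (TAdd (TScale a s) (TScale b s))"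
| scale_scale: "lie_eq (TScale a (TScale b s)) (TScale (a * b) s)"
| scale_one: "lie_eq (TScale 1 s) s"
| br_add_left: "lie_eq (TBr (TAdd s t) u) (TAdd (TBr s u) (TBr t u))"
| br_add_right: "lie_eq (TBr s (TAdd t u)) (TAdd (TBr s t) (TBr s u))"
| br_scale_left: "lie_eq (TBr (TScale a s) t) (TScale a (TBr s t))"
| br_scale_right: "lie_eq (TBr s (TScale a t)) (TScale a (TBr s t))"
| br_self: "lie_eq (TBr s s) TZero"
| br_jacobi: "lie_eq (TAdd (TAdd (TBr s (TBr t u)) (TBr t (TBr u s))) (TBr u (TBr s t))) TZero"

quotient_type (overloaded) ('k, 'x) free_lie = "('k::field, 'x) lie_term" / lie_eq
  by (intro equivpI reflpI sympI transpI) (blast intro: lie_eq.intros)+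

instantiation free_lie :: (field, type) ab_group_add
begin

lift_definition zero_free_lie :: "('a, 'b) free_lie" is TZero .

lift_definition plus_free_lie :: "('a, 'b) free_lie \<Rightarrow> ('a, 'b) free_lie \<Rightarrow> ('a, 'b) free_lie"
  is TAdd by (rule lie_eq.cong_add)

lift_definition uminus_free_lie :: "('a, 'b) free_lie \<Rightarrow> ('a, 'b) free_lie"
  is "TScale (- 1)" by (rule lie_eq.cong_scale)

definition minus_free_lie :: "('a, 'b) free_lie \<Rightarrow> ('a, 'b) free_lie \<Rightarrow> ('a, 'b) free_lie" where
  "minus_free_lie x y = x + - y"

instance
proof
  fix x y z :: "('a, 'b) free_lie"
  show "x + y + z = x + (y + z)" by transfer (rule lie_eq.add_assoc)
  show "x + y = y + x" by transfer (rule lie_eq.add_comm)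
  show "0 + x = x" by transfer (rule lie_eq.add_zero)
  show "- x + x = 0" by transfer (rule lie_eq.add_inv)
  show "x - y = x + - y" by (rule minus_free_lie_def)
qed

end

lift_definition fgen :: "'x \<Rightarrow> ('k::field, 'x) free_lie" is TGen .

lift_definition fscale :: "'k::field \<Rightarrow> ('k, 'x) free_lie \<Rightarrow> ('k, 'x) free_lie"
  is TScale by (rule lie_eq.cong_scale)

lift_definition fbracket :: "('k::field, 'x) free_lie \<Rightarrow> ('k, 'x) free_lie \<Rightarrow> ('k, 'x) free_lie"
  is TBr by (rule lie_eq.cong_br)

interpretation free: lie_algebra "fscale :: 'k::field \<Rightarrow> ('k, 'x) free_lie \<Rightarrow> ('k, 'x) free_lie" fbracket
proof
  fix x y z :: "('k, 'x) free_lie" and a b :: 'k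
  show "fscale a (x + y) = fscale a x + fscale a y" by transfer (rule lie_eq.scale_add)
  show "fscale (a + b) x = fscale a x + fscale b x" by transfer (rule lie_eq.add_scale)
  show "fscale a (fscale b x) = fscale (a * b) x" by transfer (rule lie_eq.scale_scale)
  show "fscale 1 x = x" by transfer (rule lie_eq.scale_one)
  show "fbracket (x + y) z = fbracket x z + fbracket y z" by transfer (rule lie_eq.br_add_left)
  show "fbracket x (y + z) = fbracket x y + fbracket x z" by transfer (rule lie_eq.br_add_right)
  show "fbracket (fscale a x) y = fscale a (fbracket x y)" by transfer (rule lie_eq.br_scale_left)
  show "fbracket x (fscale a y) = fscale a (fbracket x y)" by transfer (rule lie_eq.br_scale_right)
  show "fbracket x x = 0" by transfer (rule lie_eq.br_self)
  show "fbracket x (fbracket y z) + fbracket y (fbracket z x) + fbracket z (fbracket x y) = 0"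
    by transfer (rule lie_eq.br_jacobi)
qed

context lie_algebra
begin

primrec term_eval :: "('x \<Rightarrow> 'l) \<Rightarrow> ('k, 'x) lie_term \<Rightarrow> 'l" where
  "term_eval f (TGen x) = f x"
| "term_eval f TZero = 0"
| "term_eval f (TAdd s t) = term_eval f s + term_eval f t"
| "term_eval f (TScale a s) = scale a (term_eval f s)"
| "term_eval f (TBr s t) = bracket (term_eval f s) (term_eval f t)"

lemma term_eval_cong: "lie_eq s t \<Longrightarrow> term_eval f s = term_eval f t"
proof (induction rule: lie_eq.induct)
  case (add_comm s t)
  then show ?case by (simp add: add.commute)
next
  case (br_jacobi s t u)
  then show ?case by (simp add: jacobi)
qed (simp_all add: add.assoc scale_left_distrib scale_right_distrib scale_minus_left
      bracket_add_left bracket_add_right bracket_scale_left bracket_scale_right bracket_self)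

theorem free_lie_universal:
  fixes f :: "'x \<Rightarrow> 'l"
  shows "\<exists>!h. lie_hom (fscale :: 'k \<Rightarrow> ('k, 'x) free_lie \<Rightarrow> _) fbracket scale bracket h
              \<and> (\<forall>x. h (fgen x) = f x)"
proof -
  define h where "h = (\<lambda>y :: ('k, 'x) free_lie. term_eval f (rep_free_lie y))"
  have h: "h (abs_free_lie t) = term_eval f t" for t
    unfolding h_def
    by (intro term_eval_cong Quotient_rep_abs[OF Quotient_free_lie] lie_eq.refl)
  have hom: "lie_hom fscale fbracket scale bracket h"
  proof -
    have "h (x + y) = h x + h y" for x y
      by (induct x rule: free_lie.abs_induct; induct y rule: free_lie.abs_induct) (simp add: plus_free_lie.abs_eq h)
    moreover have "h (fscale a x) = scale a (h x)" for a x
      by (induct x rule: free_lie.abs_induct) (simp add: fscale.abs_eq h)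
    moreover have "h (fbracket x y) = bracket (h x) (h y)" for x y
      by (induct x rule: free_lie.abs_induct; induct y rule: free_lie.abs_induct) (simp add: fbracket.abs_eq h)
    moreover have "vector_space (fscale :: 'k \<Rightarrow> ('k, 'x) free_lie \<Rightarrow> _)" "vector_space scale"
      by unfold_locales
    ultimately show ?thesis
      by (auto simp: lie_hom_def Vector_Spaces.linear_iff)
  qed
  have gen: "h (fgen x) = f x" for x
    by (simp add: fgen.abs_eq h)
  have "g = h" if g: "lie_hom fscale fbracket scale bracket g" "\<forall>x. g (fgen x) = f x" for g
  proof
    fix y :: "('k, 'x) free_lie"
    interpret g: Vector_Spaces.linear fscale scale g
      using g(1) by (simp add: lie_hom_def)
    have br: "g (fbracket x y) = bracket (g x) (g y)" for x y
      using g(1) by (simp add: lie_hom_def)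
    have "g (abs_free_lie t) = term_eval f t" for t
    proof (induction t)
      case (TGen x)
      then show ?case using g(2) by (simp add: fgen.abs_eq)
    next
      case TZero
      then show ?case using g.zero by (simp add: zero_free_lie.abs_eq)
    next
      case (TAdd s t)
      then show ?case using g.add[of "abs_free_lie s" "abs_free_lie t"]
        by (simp add: plus_free_lie.abs_eq)
    next
      case (TScale a t)
      then show ?case using g.scale[of a "abs_free_lie t"] by (simp add: fscale.abs_eq)
    next
      case (TBr s t)
      then show ?case using br[of "abs_free_lie s" "abs_free_lie t"]
        by (simp add: fbracket.abs_eq)
    qed
    then show "g y = h y"
      by (induct y rule: free_lie.abs_induct) (simp add: h)
  qed
  with hom gen show ?thesis by blast
qed

end

section \<open>The Schur multiplier\<close>

text \<open>
  A free presentation of L is a surjective homomorphism p from a free Lie algebra F onto L; its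
  kernel R is the ideal of relations. The Schur multiplier of L is the quotient of
  \<^term>\<open>schur_num p\<close>, the intersection of R with [F, F], by \<^term>\<open>schur_den p\<close>, which is [R, F].
\<close>

definition free_presentation ::
  "('k::field \<Rightarrow> 'l::ab_group_add \<Rightarrow> 'l) \<Rightarrow> ('l \<Rightarrow> 'l \<Rightarrow> 'l) \<Rightarrow> (('k, 'x) free_lie \<Rightarrow> 'l) \<Rightarrow> bool" where
  "free_presentation s b p \<longleftrightarrow> lie_hom fscale fbracket s b p \<and> surj p"

definition relations :: "(('k::field, 'x) free_lie \<Rightarrow> 'l::ab_group_add) \<Rightarrow> ('k, 'x) free_lie set" where
  "relations p = {x. p x = 0}"

definition schur_num :: "(('k::field, 'x) free_lie \<Rightarrow> 'l::ab_group_add) \<Rightarrow> ('k, 'x) free_lie set" where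
  "schur_num p = relations p \<inter> free.commutator UNIV UNIV"

definition schur_den :: "(('k::field, 'x) free_lie \<Rightarrow> 'l::ab_group_add) \<Rightarrow> ('k, 'x) free_lie set" where
  "schur_den p = free.commutator (relations p) UNIV"

definition fin_dim_schur :: "(('k::field, 'x) free_lie \<Rightarrow> 'l::ab_group_add) \<Rightarrow> bool" where
  "fin_dim_schur p \<longleftrightarrow> free.fin_dim_quot (schur_num p) (schur_den p)"

definition dim_schur :: "(('k::field, 'x) free_lie \<Rightarrow> 'l::ab_group_add) \<Rightarrow> nat" where
  "dim_schur p = free.quot_dim (schur_num p) (schur_den p)"

lemma (in lie_algebra) free_presentation_exists:
  "\<exists>p :: ('k, 'l) free_lie \<Rightarrow> 'l. free_presentation scale bracket p"
proof -
  obtain p :: "('k, 'l) free_lie \<Rightarrow> 'l"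
    where "lie_hom fscale fbracket scale bracket p" "\<forall>x. p (fgen x) = x"
    using free_lie_universal[of "\<lambda>x. x"] by auto
  then show ?thesis
    unfolding free_presentation_def by (metis surjI)
qed

end

theory Submission
  imports Defs "HOL-Computational_Algebra.Formal_Laurent_Series"
begin

text \<open>
  Let F be the free Lie algebra and R the kernel of the presentation p. The derived algebra
  [F, F] modulo [R, F] has dimension dim M(L) + dim [L, L], and dim [L, L] = n - 2 for an algebra of
  maximal class. So it suffices to show that this dimension is at most n - 1 + (n - 1) div 2
  (lemma \<open>card_le_of_quot_independent\<close>). A linear functional on F that vanishes on [R, F] yields, through
  the bracket of F, an alternating 2-cocycle on L; the task is to bound the dimension of the
  space of 2-cocycles.

  Suppose first that L has generators x and y for which e(0) = y, e(i + 1) = [e(i), x] are, together with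
  x, a basis of L. A cocycle \<beta> satisfies
  \<beta>([v, x], w) + \<beta>(v, [w, x]) = \<beta>(x, [w, v]). If the n - 1 values \<beta>(x, e(i)) vanish, then moving x from one
  argument to the other gives \<beta>(e(i), e(j)) = (-1)^i \<beta>(y, e(i + j)). By antisymmetry these vanish for
  even i + j, so that \<beta> is determined by its n - 1 values \<beta>(x, e(i)) and by the values
  \<beta>(y, e(s)) with s odd and s < n - 1; there are (n - 1) div 2 of the latter.

  Over a small field such an x need not exist, because x has to avoid the two-step centralizers,
  the lines in L / [L, L] that centralize some quotient of the lower central series two steps apart.
  Scalars are therefore extended to the Laurent series in t over k, and x is replaced by x + t y. Its
  direction in L / [L, L] is not defined over k, while all two-step centralizers are, so it avoids
  all of them. The extended Lie algebra is never constructed: only its functionals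
  are used, which are the k-linear maps f from L to the Laurent series. The dual of the bracket
  with x + t y is the operator \<open>shift\<close>, and the value f(e(i)) is the i-th iterate of the shift
  of f, evaluated at y. That these values determine f (lemma \<open>functional_eq_0\<close>) replaces the basis
  above, and lemma \<open>cocycle_eq_0\<close> is the argument about cocycles.

  If the family of functionals on F were too large, Gaussian elimination over the
  Laurent series would give a nontrivial combination of their cocycles that satisfies all
  the vanishing conditions and so is zero. Each Laurent coefficient of that combination is
  a linear dependency over k, which contradicts independence modulo [R, F].
\<close>

section \<open>Linear algebra\<close>

text \<open>
  Gaussian elimination: a homogeneous system with fewer equations than unknowns has a nonzero
  solution.
\<close>

lemma nontrivial_kernel:
  fixes A :: "'i \<Rightarrow> 'j \<Rightarrow> 'f::field"
  assumes "finite J" "finite I" "card J < card I"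
  shows "\<exists>c. (\<exists>i\<in>I. c i \<noteq> 0) \<and> (\<forall>j\<in>J. (\<Sum>i\<in>I. c i * A i j) = 0)"
  using assms
proof (induction J arbitrary: I A rule: finite_induct)
  case empty
  then have "I \<noteq> {}" by auto
  then show ?case by (intro exI[of _ "\<lambda>_. 1"]) auto
next
  case (insert j0 J)
  show ?case
  proof (cases "\<forall>i\<in>I. A i j0 = 0")
    case True
    have "card J < card I" using insert.hyps insert.prems by simp
    then obtain c where "\<exists>i\<in>I. c i \<noteq> 0" "\<forall>j\<in>J. (\<Sum>i\<in>I. c i * A i j) = 0"
      using insert.IH[of I A] insert.prems by blast
    then show ?thesis using True by (intro exI[of _ c]) auto
  next
    case False
    then obtain i0 where i0: "i0 \<in> I" "A i0 j0 \<noteq> 0" by blast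
    define I' where "I' = I - {i0}"
    have I': "finite I'" "card J < card I'" "i0 \<notin> I'" "I = Set.insert i0 I'"
      using insert.hyps insert.prems i0 by (auto simp: I'_def)
    obtain c where c: "\<exists>i\<in>I'. c i \<noteq> 0"
      and eq: "\<forall>j\<in>J. (\<Sum>i\<in>I'. c i * (A i j - A i j0 / A i0 j0 * A i0 j)) = 0"
      using insert.IH[of I' "\<lambda>i j. A i j - A i j0 / A i0 j0 * A i0 j"] I' by blast
    define c' where "c' = (\<lambda>i. if i = i0 then - (\<Sum>i\<in>I'. c i * A i j0) / A i0 j0 else c i)"
    have I'c': "(\<Sum>i\<in>I'. c' i * A i j) = (\<Sum>i\<in>I'. c i * A i j)" for j
      using I'(3) by (intro sum.cong) (auto simp: c'_def)
    have sum: "(\<Sum>i\<in>I. c' i * A i j) =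
        (\<Sum>i\<in>I'. c i * A i j) - (\<Sum>i\<in>I'. c i * A i j0) / A i0 j0 * A i0 j" for j
      using I' I'c'[of j] by (simp add: c'_def)
    have "(\<Sum>i\<in>I. c' i * A i j) = 0" if "j \<in> Set.insert j0 J" for j
    proof (cases "j = j0")
      case True
      then show ?thesis using sum[of j] i0 by simp
    next
      case False
      have "(\<Sum>i\<in>I'. c i * (A i j - A i j0 / A i0 j0 * A i0 j)) =
          (\<Sum>i\<in>I'. c i * A i j) - (\<Sum>i\<in>I'. c i * A i j0) / A i0 j0 * A i0 j"
        by (simp add: algebra_simps sum_subtractf sum_distrib_left sum_divide_distrib)
      with False that eq show ?thesis using sum[of j] by simp
    qed
    moreover have "\<exists>i\<in>I. c' i \<noteq> 0"
      using c I'(3,4) by (auto simp: c'_def)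
    ultimately show ?thesis by blast
  qed
qed

lemma vector_space_field: "vector_space ((*) :: 'k::field \<Rightarrow> 'k \<Rightarrow> 'k)"
  by unfold_locales (auto simp: algebra_simps)

context vector_space
begin

lemma codim_le_1:
  assumes fd: "finite_dimensional_vector_space scale Basis"
    and U: "local.subspace U" and W: "local.subspace W"
    and UW: "U \<subseteq> W" "local.dim W \<le> local.dim U + 1"
  obtains b where "b \<in> W" "\<And>w. w \<in> W \<Longrightarrow> \<exists>a. w - scale a b \<in> U"
proof (cases "W \<subseteq> U")
  case True
  have "w - scale 0 0 \<in> U" if "w \<in> W" for w using True that by auto
  then show ?thesis using that[of 0] W subspace_0 by blast
next
  case False
  interpret fd: finite_dimensional_vector_space scale Basis by fact
  obtain b where b: "b \<in> W" "b \<notin> U" using False by blast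
  have spU: "local.span U = U" using U by (simp add: span_eq_iff)
  have "local.span (insert b U) \<subseteq> W"
    using b UW W by (intro span_minimal) auto
  moreover have "local.dim (insert b U) = local.dim U + 1"
    using fd.dim_insert[of b U] b spU by simp
  ultimately have "local.span (insert b U) = W"
    using UW W by (intro fd.subspace_dim_equal) auto
  then have "\<exists>a. w - scale a b \<in> U" if "w \<in> W" for w
    using that span_breakdown_eq[of w b U] spU by auto
  with b that show ?thesis by blast
qed

text \<open>
  A set that is independent modulo B extends a basis of B to an independent set, on which
  functionals can be prescribed.
\<close>

lemma dual_functionals:
  assumes B: "local.subspace B" and S: "local.quot_independent B S"
  obtains \<phi> where "\<And>s. Vector_Spaces.linear scale (*) (\<phi> s)"
    "\<And>s v. s \<in> S \<Longrightarrow> v \<in> B \<Longrightarrow> \<phi> s v = 0"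
    "\<And>s r. s \<in> S \<Longrightarrow> r \<in> S \<Longrightarrow> \<phi> s r = (if r = s then 1 else 0)"
proof -
  obtain E where E: "E \<subseteq> B" "local.independent E" "B \<subseteq> local.span E"
    by (rule basis_exists[of B])
  have disj: "S \<inter> B = {}"
  proof (rule ccontr)
    assume "S \<inter> B \<noteq> {}"
    then obtain v where "v \<in> S" "v \<in> B" by blast
    then show False
      using S[unfolded quot_independent_def, rule_format, of "{v}" "\<lambda>_. 1" v] by simp
  qed
  have ind: "local.independent (E \<union> S)"
  proof
    assume "local.dependent (E \<union> S)"
    then obtain T u where T: "finite T" "T \<subseteq> E \<union> S" "(\<Sum>v\<in>T. scale (u v) v) = 0" "\<exists>v\<in>T. u v \<noteq> 0"
      unfolding dependent_explicit by blast
    have split: "(\<Sum>v\<in>T \<inter> S. scale (u v) v) + (\<Sum>v\<in>T - S. scale (u v) v) = 0"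
      using sum.Int_Diff[OF T(1), of "\<lambda>v. scale (u v) v" S] T(3) by (simp only:)
    have "(\<Sum>v\<in>T - S. scale (u v) v) \<in> B"
      using T E B by (intro subspace_sum subspace_scale) auto
    moreover have "(\<Sum>v\<in>T \<inter> S. scale (u v) v) = - (\<Sum>v\<in>T - S. scale (u v) v)"
      using split by (rule add_eq_0_iff2[THEN iffD1])
    ultimately have "(\<Sum>v\<in>T \<inter> S. scale (u v) v) \<in> B"
      using subspace_neg[OF B] by (simp only:)
    then have 1: "\<forall>v\<in>T \<inter> S. u v = 0"
      using S[unfolded quot_independent_def, rule_format, of "T \<inter> S" u] T(1) by blast
    then have "(\<Sum>v\<in>T - S. scale (u v) v) = 0" using split by simp
    moreover have "finite (T - S)" "T - S \<subseteq> E" using T by auto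
    ultimately have "\<forall>v\<in>T - S. u v = 0"
      using independentD[OF E(2), of "T - S" u] by blast
    with 1 T(4) show False by blast
  qed
  interpret vs: vector_space_pair scale "(*) :: 'a \<Rightarrow> 'a \<Rightarrow> 'a"
    using vector_space_axioms vector_space_field by (rule vector_space_pair.intro)
  have "\<forall>s. \<exists>g. Vector_Spaces.linear scale (*) g \<and> (\<forall>v\<in>E \<union> S. g v = (if v = s then 1 else (0::'a)))"
    by (intro allI vs.linear_independent_extend[OF ind])
  from choice[OF this] have "\<exists>\<phi>. \<forall>s. Vector_Spaces.linear scale (*) (\<phi> s) \<and>
      (\<forall>v\<in>E \<union> S. \<phi> s v = (if v = s then 1 else (0::'a)))" .
  then obtain \<phi> where \<phi>: "\<And>s. Vector_Spaces.linear scale (*) (\<phi> s)"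
      "\<And>s v. v \<in> E \<union> S \<Longrightarrow> \<phi> s v = (if v = s then 1 else (0::'a))"
    by blast
  have "\<phi> s v = 0" if "s \<in> S" "v \<in> B" for s v
  proof (rule vs.linear_eq_0_on_span[OF \<phi>(1)])
    show "v \<in> local.span E" using that E by blast
    fix w assume "w \<in> E"
    moreover have "s \<noteq> w" if "w \<in> E" using that \<open>s \<in> S\<close> disj E by blast
    ultimately show "\<phi> s w = 0" using \<phi>(2)[of w s] by simp
  qed
  moreover have "\<phi> s r = (if r = s then 1 else 0)" if "r \<in> S" for s r
    using \<phi>(2)[of r s] that by blast
  ultimately show ?thesis using that[of \<phi>] \<phi>(1) by blast
qed

text \<open>
  The definition of \<^term>\<open>local.quot_dim\<close> picks an arbitrary basis of the quotient. A bound on all finite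
  independent sets controls every choice, and a largest such set shows that a finite basis exists.
\<close>

lemma quot_dim_le:
  assumes B: "local.subspace B" and A: "local.subspace A"
    and le: "\<And>C. finite C \<Longrightarrow> C \<subseteq> A \<Longrightarrow> local.quot_independent B C \<Longrightarrow> card C \<le> N"
  shows "local.fin_dim_quot A B" and "local.quot_dim A B \<le> N"
proof -
  define P where "P m \<longleftrightarrow> (\<exists>C. finite C \<and> C \<subseteq> A \<and> local.quot_independent B C \<and> card C = m)" for m
  have "P 0" unfolding P_def quot_independent_def by (intro exI[of _ "{}"]) auto
  moreover have "m \<le> N" if "P m" for m
    using that le unfolding P_def by auto
  ultimately have "P (Greatest P)" "\<forall>m'. P m' \<longrightarrow> m' \<le> Greatest P"
    by (auto intro: GreatestI_nat[of P 0 N] Greatest_le_nat[of P _ N])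
  then obtain m where m: "P m" "\<forall>m'. P m' \<longrightarrow> m' \<le> m" by blast
  then obtain C where C: "finite C" "C \<subseteq> A" "local.quot_independent B C" "card C = m"
    unfolding P_def by blast
  have "A \<subseteq> local.span (B \<union> C)"
  proof (rule ccontr)
    assume "\<not> A \<subseteq> local.span (B \<union> C)"
    then obtain v where v: "v \<in> A" "v \<notin> local.span (B \<union> C)" by blast
    have "v \<notin> C" using v span_base by blast
    have "local.quot_independent B (insert v C)"
      unfolding quot_independent_def
    proof (intro allI impI)
      fix T u assume T: "finite T" "T \<subseteq> insert v C" and s: "(\<Sum>w\<in>T. scale (u w) w) \<in> B"
      have 1: "u v = 0" if "v \<in> T"
      proof (rule ccontr)
        assume "u v \<noteq> 0"
        have 2: "(\<Sum>w\<in>T - {v}. scale (u w) w) \<in> local.span (B \<union> C)"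
          using T by (intro span_sum span_scale span_base) auto
        have 3: "scale (u v) v = (\<Sum>w\<in>T. scale (u w) w) - (\<Sum>w\<in>T - {v}. scale (u w) w)"
          using sum.remove[OF T(1) that, of "\<lambda>w. scale (u w) w"] by simp
        have "scale (u v) v \<in> local.span (B \<union> C)"
          unfolding 3 by (intro span_diff 2 span_base UnI1 s)
        then have "scale (inverse (u v)) (scale (u v) v) \<in> local.span (B \<union> C)"
          by (rule span_scale)
        then show False using v \<open>u v \<noteq> 0\<close> by simp
      qed
      have "(\<Sum>w\<in>T. scale (u w) w) = (\<Sum>w\<in>T - {v}. scale (u w) w)"
        using T 1 by (intro sum.mono_neutral_right) auto
      then have "(\<Sum>w\<in>T - {v}. scale (u w) w) \<in> B" "finite (T - {v})" "T - {v} \<subseteq> C"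
        using s T by auto
      then have "\<forall>w\<in>T - {v}. u w = 0"
        using C(3)[unfolded quot_independent_def, rule_format, of "T - {v}" u] by blast
      with 1 show "\<forall>w\<in>T. u w = 0" by blast
    qed
    then have "P (Suc m)"
      unfolding P_def using C(1,2,4) v(1) \<open>v \<notin> C\<close> by (intro exI[of _ "insert v C"]) simp
    with m(2) have "Suc m \<le> m" by blast
    then show False by simp
  qed
  then have C: "finite C" "local.quot_basis A B C" using C by (auto simp: quot_basis_def)
  then show "local.fin_dim_quot A B" by (auto simp: fin_dim_quot_def)
  define C' where "C' = (SOME C. local.quot_basis A B C)"
  have "local.quot_basis A B C'" unfolding C'_def using C(2) by (rule someI)
  then have C': "C' \<subseteq> A" "local.quot_independent B C'" by (auto simp: quot_basis_def)
  have "card C' \<le> N"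
    using le[of C'] C' by (cases "finite C'") auto
  then show "local.quot_dim A B \<le> N" by (simp add: quot_dim_def C'_def)
qed

end


section \<open>The lower central series of a Lie algebra of maximal class\<close>

context lie_algebra
begin

lemma bracket_zero [simp]: "bracket 0 w = 0" "bracket v 0 = 0"
  using bracket_scale_left[of 0 0 w] bracket_scale_right[of v 0 0] by simp_all

lemma bracket_minus_left: "bracket (- v) w = - bracket v w"
  using bracket_scale_left[of "-1" v w] by simp

lemma bracket_diff_left: "bracket (u - v) w = bracket u w - bracket v w"
  using bracket_add_left[of u "- v" w] by (simp add: bracket_minus_left)

lemma bracket_swap: "bracket w v = - bracket v w"
proof -
  have "bracket (v + w) (v + w) = bracket v w + bracket w v"
    unfolding bracket_add_left bracket_add_right by (simp add: bracket_self)
  then show ?thesis by (simp add: bracket_self eq_neg_iff_add_eq_0 add.commute)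
qed

lemma bracket_diff_right: "bracket u (v - w) = bracket u v - bracket u w"
  using bracket_diff_left[of v w u] by (simp add: bracket_swap[of u])

lemma subspace_lower_central: "local.subspace (lower_central i)"
  by (induction i rule: lower_central.induct) (simp_all add: commutator_def)

lemma lower_central_Suc:
  "1 \<le> i \<Longrightarrow> lower_central (Suc i) = local.span {bracket v w |v w. v \<in> lower_central i}"
  by (cases i) (simp_all add: commutator_def)

lemma lower_central_2: "lower_central 2 = local.span {bracket v w |v w. True}"
  using lower_central_Suc[of 1] by (simp add: numeral_2_eq_2)

lemma bracket_lower_central:
  assumes "1 \<le> i" "v \<in> lower_central i"
  shows "bracket v w \<in> lower_central (Suc i)"
  unfolding lower_central_Suc[OF assms(1)] using assms(2) by (intro span_base) blast

lemma lower_central_decreasing: "1 \<le> i \<Longrightarrow> lower_central (Suc i) \<subseteq> lower_central i"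
proof (induction i rule: nat_induct_at_least)
  case base
  then show ?case by simp
next
  case (Suc i)
  have "bracket v w \<in> lower_central (Suc i)" if "v \<in> lower_central (Suc i)" for v w
    using bracket_lower_central[of i v w] that Suc by blast
  then have "local.span {bracket v w |v w. v \<in> lower_central (Suc i)} \<subseteq> lower_central (Suc i)"
    by (intro span_minimal subspace_lower_central) blast
  then show ?case using lower_central_Suc[of "Suc i"] by simp
qed

lemma lower_central_stationary:
  assumes "1 \<le> i" "lower_central (Suc i) = lower_central i" "i \<le> j"
  shows "lower_central j = lower_central i"
  using assms(3)
proof (induction j rule: dec_induct)
  case (step j)
  then show ?case
    using assms(1,2) lower_central_Suc[of j] lower_central_Suc[of i] by simp
qed simp

lemma lower_central_strict:
  assumes "nilpotent_of_class c" "1 \<le> i" "i \<le> c"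
  shows "lower_central (Suc i) \<noteq> lower_central i"
  using lower_central_stationary[of i c] lower_central_stationary[of i "c + 1"] assms
  unfolding nilpotent_of_class_def by fastforce

text \<open>
  If L / [L, L] is spanned by one element x, then [x, x] = 0 makes every bracket fall one step
  further down the series. This forces dim L / [L, L] to be at least 2 as long as the third term
  differs from the second.
\<close>

lemma lower_central_2_of_cyclic:
  assumes "\<And>v. \<exists>a. v - scale a x \<in> lower_central 2"
  shows "lower_central 2 \<subseteq> lower_central 3"
  unfolding lower_central_2
proof (intro span_minimal subspace_lower_central, clarify)
  fix v w
  have 3: "bracket u z \<in> lower_central 3" if "u \<in> lower_central 2" for u z
    using bracket_lower_central[of 2 u z] that by (simp add: numeral_3_eq_3)
  obtain a where a: "v - scale a x \<in> lower_central 2" using assms by blast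
  obtain b where b: "w - scale b x \<in> lower_central 2" using assms by blast
  have "bracket v w = bracket (v - scale a x) w - scale a (bracket (w - scale b x) x)"
    by (simp add: bracket_diff_left bracket_scale_left bracket_self bracket_swap[of w x])
  then show "bracket v w \<in> lower_central 3"
    using 3[OF a] 3[OF b] subspace_lower_central[of 3]
    by (simp add: subspace_diff subspace_scale)
qed

end

text \<open>
  What the bound on cocycles uses about an algebra of maximal class: two generators, layers of
  dimension at most one, and termination at index n.
\<close>

locale maximal_class_frame = lie_algebra scale bracket
  for scale :: "'k::field \<Rightarrow> 'l::ab_group_add \<Rightarrow> 'l" and bracket +
  fixes n :: nat and x y :: 'l
  assumes n_ge_2: "2 \<le> n"
    and generators: "\<exists>a b. v - (scale a x + scale b y) \<in> lower_central 2"
    and layer: "2 \<le> j \<Longrightarrow> j < n \<Longrightarrow>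
      \<exists>b \<in> lower_central j. \<forall>v \<in> lower_central j. \<exists>a. v - scale a b \<in> lower_central (Suc j)"
    and vanish: "lower_central n = {0}"

context lie_algebra
begin

text \<open>
  The series descends strictly from dimension n to dimension 0 in n - 1 steps and the first
  step drops the dimension by at least 2, so every later step drops it by exactly 1.
\<close>

lemma maximal_class_dims:
  assumes "maximal_class n"
  shows "2 \<le> n" and "\<And>j. 2 \<le> j \<Longrightarrow> j \<le> n \<Longrightarrow> local.dim (lower_central j) = n - j"
    and "\<exists>x y. maximal_class_frame scale bracket n x y"
proof -
  obtain c where c: "nilpotent_of_class c" "c + 1 = n"
    using assms by (auto simp: maximal_class_def)
  obtain Basis where fd: "finite_dimensional_vector_space scale Basis"
    using assms by (auto simp: maximal_class_def has_dimension_def)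
  interpret fd: finite_dimensional_vector_space scale Basis by fact
  have n: "local.dim (lower_central 1) = n"
    using assms by (simp add: maximal_class_def has_dimension_def)
  show n2: "2 \<le> n" using c by (auto simp: nilpotent_of_class_def)
  have last: "lower_central n = {0}" using c by (simp add: nilpotent_of_class_def)
  have strict: "local.dim (lower_central (Suc j)) < local.dim (lower_central j)"
    if "1 \<le> j" "j < n" for j
  proof (rule ccontr)
    assume "\<not> ?thesis"
    then have "lower_central (Suc j) = lower_central j"
      using lower_central_decreasing[OF that(1)]
      by (intro fd.subspace_dim_equal subspace_lower_central) auto
    then show False using lower_central_strict[OF c(1) that(1)] that c(2) by simp
  qed
  have lower: "n - j \<le> local.dim (lower_central j)" if "1 \<le> j" "j \<le> n" for j
    using that(2) that(1)
  proof (induction j rule: inc_induct)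
    case (step j)
    then show ?case using strict[of j] by simp
  qed simp
  have two: "local.dim (lower_central 2) \<le> n - 2"
  proof (cases "n = 2")
    case True
    then show ?thesis using last by simp
  next
    case False
    show ?thesis
    proof (rule ccontr)
      assume "\<not> ?thesis"
      then have "local.dim (lower_central 1) \<le> local.dim (lower_central 2) + 1"
        using n by simp
      moreover have "lower_central 2 \<subseteq> lower_central 1" by simp
      ultimately obtain b where "\<And>w. w \<in> lower_central 1 \<Longrightarrow> \<exists>a. w - scale a b \<in> lower_central 2"
        using codim_le_1[OF fd subspace_lower_central subspace_lower_central] by metis
      then have "lower_central 2 \<subseteq> lower_central 3"
        by (intro lower_central_2_of_cyclic) simp
      then show False
        using strict[of 2] fd.dim_subset[of "lower_central 2" "lower_central 3"] n2 False
        by (simp add: numeral_3_eq_3)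
    qed
  qed
  show dim: "local.dim (lower_central j) = n - j" if "2 \<le> j" "j \<le> n" for j
  proof (rule antisym)
    show "n - j \<le> local.dim (lower_central j)" using lower[of j] that by simp
    show "local.dim (lower_central j) \<le> n - j"
      using that
    proof (induction j rule: dec_induct)
      case (step j)
      then show ?case using strict[of j] by simp
    qed (use two in simp)
  qed
  have layer: "\<exists>b \<in> lower_central j. \<forall>v \<in> lower_central j. \<exists>a. v - scale a b \<in> lower_central (Suc j)"
    if "2 \<le> j" "j < n" for j
  proof -
    have "local.dim (lower_central j) \<le> local.dim (lower_central (Suc j)) + 1"
      using dim[of j] dim[of "Suc j"] that by simp
    from codim_le_1[OF fd subspace_lower_central subspace_lower_central lower_central_decreasing this]
    show ?thesis using that by (metis Suc_1 Suc_leD)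
  qed
  have "\<not> UNIV \<subseteq> lower_central 2"
    using strict[of 1] fd.dim_subset[of UNIV "lower_central 2"] n2 by (auto simp: numeral_2_eq_2)
  then obtain y where y: "y \<notin> lower_central 2" by blast
  define U where "U = local.span (insert y (lower_central 2))"
  have sp: "local.span (lower_central 2) = lower_central 2"
    using subspace_lower_central by (simp add: span_eq_iff)
  have "local.dim U = n - 1"
    using fd.dim_insert[of y "lower_central 2"] sp y dim[of 2] n2 by (simp add: U_def)
  then have "local.dim UNIV \<le> local.dim U + 1" using n by simp
  moreover have "local.subspace U" by (simp add: U_def)
  ultimately obtain x where x: "\<And>w. w \<in> UNIV \<Longrightarrow> \<exists>a. w - scale a x \<in> U"
    using codim_le_1[OF fd _ subspace_UNIV subset_UNIV] by metis
  have "\<exists>a b. v - (scale a x + scale b y) \<in> lower_central 2" for v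
  proof -
    obtain a where "v - scale a x \<in> U" using x by blast
    then obtain b where "v - scale a x - scale b y \<in> lower_central 2"
      unfolding U_def span_breakdown_eq sp by blast
    then show ?thesis by (auto simp: diff_diff_eq)
  qed
  then show "\<exists>x y. maximal_class_frame scale bracket n x y"
    using n2 layer last by (intro exI[of _ x] exI[of _ y]) unfold_locales
qed

end


section \<open>Shifting functionals along a generic element\<close>

text \<open>
  Laurent series as a vector space over the field of constants, so that functionals with
  values in the extended field are linear maps over the original field.
\<close>

definition laurent_scale :: "'k::field \<Rightarrow> 'k fls \<Rightarrow> 'k fls" where
  "laurent_scale a z = fls_const a * z"

interpretation laurent: vector_space laurent_scale
  by unfold_locales
    (simp_all add: laurent_scale_def algebra_simps fls_plus_const[symmetric]
      fls_const_mult_const[symmetric] del: fls_const_mult_const)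

text \<open>
  The indeterminate is not a constant; this is what makes x + t y avoid every two-step centralizer.
\<close>

lemma generic_combination_eq_0:
  assumes "fls_const a + fls_X * fls_const b = (0 :: 'k::field fls)"
  shows "a = 0" and "b = 0"
proof -
  have "fls_nth (fls_const a + fls_const b * fls_X) m = 0" for m
    using assms by (simp add: mult.commute)
  from this[of 0] this[of 1] show "a = 0" "b = 0" by simp_all
qed

context maximal_class_frame
begin

abbreviation functional :: "('l \<Rightarrow> 'k fls) \<Rightarrow> bool" where
  "functional f \<equiv> Vector_Spaces.linear scale laurent_scale f"

lemma functional_simps:
  assumes "functional f"
  shows "f (u + v) = f u + f v" and "f (scale a v) = fls_const a * f v" and "f 0 = 0"
    and "f (u - v) = f u - f v" and "f (- v) = - f v"
proof -
  interpret f: Vector_Spaces.linear scale laurent_scale f by fact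
  show "f (u + v) = f u + f v" "f (scale a v) = fls_const a * f v" "f 0 = 0"
    "f (u - v) = f u - f v" "f (- v) = - f v"
    by (simp_all add: f.add f.scale f.zero f.diff f.neg laurent_scale_def)
qed

lemma functionalI:
  assumes "\<And>u v. f (u + v) = f u + f v" and "\<And>a v. f (scale a v) = fls_const a * f v"
  shows "functional f"
  using assms vector_space_axioms laurent.vector_space_axioms
  by (simp add: Vector_Spaces.linear_iff laurent_scale_def)

lemma functional_span:
  assumes "functional f" and "\<And>v. v \<in> S \<Longrightarrow> f v = 0" and "v \<in> local.span S"
  shows "f v = 0"
proof -
  interpret f: Vector_Spaces.linear scale laurent_scale f by fact
  show ?thesis using assms(2,3) by (rule f.eq_0_on_span)
qed

text \<open>
  The dual of the right bracket with x + t y. With e(0) = y and e(i + 1) = [e(i), x + t y] in the extended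
  algebra, the i-th iterate of the shift of f takes at y the value f(e(i)).
\<close>

definition shift :: "('l \<Rightarrow> 'k fls) \<Rightarrow> 'l \<Rightarrow> 'k fls" where
  "shift f v = f (bracket v x) + fls_X * f (bracket v y)"

lemma functional_shift: "functional f \<Longrightarrow> functional (shift f)"
  by (rule functionalI)
    (simp_all add: shift_def functional_simps bracket_add_left bracket_scale_left algebra_simps)

text \<open>By the Jacobi identity [b, [u, v]] is a difference of iterated brackets of b with u and v.\<close>

lemma bracket_lower_central_2:
  assumes j: "1 \<le> j" and b: "b \<in> lower_central j" and w: "w \<in> lower_central 2"
  shows "bracket b w \<in> lower_central (Suc (Suc j))"
  using w unfolding lower_central_2
proof (induction rule: span_induct_alt)
  case base
  show ?case by (simp only: bracket_zero subspace_0[OF subspace_lower_central])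
next
  case (step c w w')
  then obtain u v where w: "w = bracket u v" by blast
  have "bracket b w = bracket (bracket b u) v - bracket (bracket b v) u"
    using jacobi[of b u v] bracket_swap[of "bracket b u" v] bracket_swap[of "bracket b v" u]
      bracket_swap[of b v] bracket_diff_right[of u 0 "bracket b v"]
    by (simp add: w algebra_simps)
  moreover have "bracket (bracket b u) v \<in> lower_central (Suc (Suc j))" for u v
    using bracket_lower_central[OF _ bracket_lower_central[OF j b]] by simp
  ultimately have "bracket b w \<in> lower_central (Suc (Suc j))"
    using subspace_lower_central[of "Suc (Suc j)"] by (simp only: subspace_diff)
  then show ?case
    using step subspace_lower_central[of "Suc (Suc j)"]
    by (simp only: bracket_add_right bracket_scale_right subspace_add subspace_scale)
qed

lemma functional_bracket_cong:
  assumes f: "functional f" "\<And>v. v \<in> lower_central (Suc j) \<Longrightarrow> f v = 0"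
    and "1 \<le> j" "v - v' \<in> lower_central j"
  shows "f (bracket v w) = f (bracket v' w)"
  using f(2)[OF bracket_lower_central[OF assms(3,4), of w]] functional_simps(4)[OF f(1)]
  by (simp add: bracket_diff_left)

lemma functional_generators:
  assumes f: "functional f" "f x = 0" "f y = 0" "\<And>v. v \<in> lower_central 2 \<Longrightarrow> f v = 0"
  shows "f v = 0"
proof -
  obtain a b where "v - (scale a x + scale b y) \<in> lower_central 2" using generators by blast
  then have "f (v - (scale a x + scale b y)) = 0" by (rule f(4))
  then show ?thesis using f by (simp add: functional_simps)
qed

text \<open>
  In the extended algebra this says that e(j - 1) is nonzero in layer j. One application of the shift
  moves the layer on which f lives down by one: if b spans layer j and b' spans layer j + 1, then
  [b, x] = a1 b' and [b, y] = a2 b' modulo the next term with constants a1 and a2, so the shift of f takes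
  at b the value (a1 + t a2) f(b'). This is zero only if a1 = a2 = 0, and then f would vanish on
  all brackets with layer j.
\<close>

lemma iterated_shift_nonzero:
  assumes "2 \<le> j" "j < n" "functional f"
    and "\<And>v. v \<in> lower_central (Suc j) \<Longrightarrow> f v = 0"
    and "\<exists>v \<in> lower_central j. f v \<noteq> 0"
  shows "(shift ^^ (j - 1)) f y \<noteq> 0"
  using assms
proof (induction j arbitrary: f rule: nat_induct_at_least)
  case base
  note f = base(2)
  show ?case
  proof
    assume "(shift ^^ (2 - 1)) f y = 0"
    then have yx: "f (bracket y x) = 0"
      using functional_simps(3)[OF f] by (simp add: shift_def bracket_self)
    then have xy: "f (bracket x y) = 0"
      using functional_simps(5)[OF f] bracket_swap[of x y] by simp
    have 3: "\<And>v. v \<in> lower_central (Suc 2) \<Longrightarrow> f v = 0" using base(3) by simp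
    have "f (bracket v w) = 0" for v w
    proof -
      have *: "f (bracket v z) = 0" if z: "f (bracket x z) = 0" "f (bracket y z) = 0" for v z
      proof -
        obtain a b where "v - (scale a x + scale b y) \<in> lower_central 2" using generators by blast
        then have "f (bracket v z) = f (bracket (scale a x + scale b y) z)"
          by (intro functional_bracket_cong[OF f 3]) auto
        then show ?thesis
          using z by (simp add: bracket_add_left bracket_scale_left functional_simps[OF f])
      qed
      have "f (bracket v x) = 0" "f (bracket v y) = 0" for v
        using * yx xy by (simp_all add: bracket_self functional_simps[OF f])
      then have "f (bracket x w) = 0" "f (bracket y w) = 0"
        using *[of x w] *[of y w] functional_simps(5)[OF f]
          bracket_swap[of x w] bracket_swap[of y w] *
        by (metis neg_equal_0_iff_equal bracket_swap)+
      then show ?thesis by (rule *)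
    qed
    then have "f v = 0" if "v \<in> lower_central 2" for v
      using functional_span[OF f _ that[unfolded lower_central_2]] \<open>\<And>v w. f (bracket v w) = 0\<close>
      by blast
    then show False using base(4) by blast
  qed
next
  case (Suc j)
  note f = Suc.prems(2)
  have top: "f v = 0" if "v \<in> lower_central (Suc (Suc j))" for v
    using Suc.prems(3) that by blast
  have "\<exists>v \<in> lower_central j. shift f v \<noteq> 0"
  proof (rule ccontr)
    assume "\<not> ?thesis"
    then have zero: "shift f v = 0" if "v \<in> lower_central j" for v using that by blast
    obtain b where b: "b \<in> lower_central j"
      "\<forall>v \<in> lower_central j. \<exists>a. v - scale a b \<in> lower_central (Suc j)"
      using layer[of j] Suc by auto
    obtain b' where b': "b' \<in> lower_central (Suc j)"
      "\<forall>v \<in> lower_central (Suc j). \<exists>a. v - scale a b' \<in> lower_central (Suc (Suc j))"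
      using layer[of "Suc j"] Suc by auto
    have multiple: "\<exists>a. f v = fls_const a * f b'" if v: "v \<in> lower_central (Suc j)" for v
    proof -
      obtain a where "v - scale a b' \<in> lower_central (Suc (Suc j))" using b' v by blast
      then have "f (v - scale a b') = 0" by (rule top)
      then show ?thesis by (auto simp: functional_simps[OF f])
    qed
    have b'0: "f b' \<noteq> 0" using Suc.prems(4) multiple by fastforce
    have "bracket b w \<in> lower_central (Suc j)" for w
      using bracket_lower_central[of j b w] b Suc by simp
    then obtain a1 a2 where a: "f (bracket b x) = fls_const a1 * f b'"
        "f (bracket b y) = fls_const a2 * f b'"
      using multiple by blast
    have "(fls_const a1 + fls_X * fls_const a2) * f b' = 0"
      using zero[OF b(1)] a by (simp add: shift_def algebra_simps)
    then have "fls_const a1 + fls_X * fls_const a2 = 0" using b'0 by simp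
    then have bxy: "f (bracket b x) = 0" "f (bracket b y) = 0"
      using a generic_combination_eq_0[of a1 a2] by simp_all
    have bw: "f (bracket b w) = 0" for w
    proof (rule functional_generators[of "\<lambda>w. f (bracket b w)"])
      show "functional (\<lambda>w. f (bracket b w))"
        by (rule functionalI)
          (simp_all add: functional_simps[OF f] bracket_add_right bracket_scale_right)
      show "f (bracket b w) = 0" if "w \<in> lower_central 2" for w
        using bracket_lower_central_2[of j b w] b that Suc.hyps top by simp
    qed (fact bxy)+
    have bracket0: "f (bracket v w) = 0" if v: "v \<in> lower_central j" for v w
    proof -
      obtain a where "v - scale a b \<in> lower_central (Suc j)" using b v by blast
      then have "f (bracket v w) = f (bracket (scale a b) w)"
        by (intro functional_bracket_cong[OF f top]) auto
      then show ?thesis using bw by (simp add: functional_simps[OF f] bracket_scale_left)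
    qed
    have "f v = 0" if "v \<in> lower_central (Suc j)" for v
    proof (rule functional_span[OF f])
      show "v \<in> local.span {bracket v w |v w. v \<in> lower_central j}"
        using that lower_central_Suc[of j] Suc.hyps by simp
    qed (use bracket0 in blast)
    then show False using Suc.prems(4) by blast
  qed
  moreover have "shift f v = 0" if "v \<in> lower_central (Suc j)" for v
    using top bracket_lower_central[of "Suc j" v] that by (simp add: shift_def)
  ultimately have "(shift ^^ (j - 1)) (shift f) y \<noteq> 0"
    using Suc.prems(1) by (intro Suc.IH functional_shift f) auto
  moreover have "(shift ^^ (Suc j - 1)) f = (shift ^^ (j - 1)) (shift f)"
    using Suc.hyps by (cases j) (simp_all add: funpow_swap1)
  ultimately show ?case by simp
qed

text \<open>
  In the extended algebra, x + t y and e(0), ..., e(n - 2) span: the lowest layer on which f does not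
  vanish would be detected by one of the values f(e(i)).
\<close>

lemma functional_eq_0:
  assumes f: "functional f" and gen: "f x + fls_X * f y = 0"
    and ev: "\<And>i. i < n - 1 \<Longrightarrow> (shift ^^ i) f y = 0"
  shows "f v = 0"
proof (rule functional_generators[OF f])
  show y: "f y = 0" using ev[of 0] n_ge_2 by simp
  show "f x = 0" using gen y by simp
  have "\<forall>v \<in> lower_central j. f v = 0" if "2 \<le> j" "j \<le> n" for j
    using that(2,1)
  proof (induction j rule: inc_induct)
    case base
    show ?case using vanish functional_simps(3)[OF f] by simp
  next
    case (step j)
    show ?case
    proof (rule ccontr)
      assume "\<not> ?thesis"
      then have "(shift ^^ (j - 1)) f y \<noteq> 0"
        using step by (intro iterated_shift_nonzero f) auto
      moreover have "j - 1 < n - 1" using step by simp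
      ultimately show False using ev by blast
    qed
  qed
  then show "f v = 0" if "v \<in> lower_central 2" for v using that n_ge_2 by blast
qed

section \<open>Cocycles\<close>

text \<open>
  The hypothesis \<open>generic\<close> says that \<beta>(x + t y, e(i)) = 0, and \<open>odd\<close> that \<beta>(y, e(i)) = 0
  for odd i. The even values vanish by antisymmetry, and this is where the characteristic matters.
\<close>

lemma cocycle_eq_0:
  fixes \<beta> :: "'l \<Rightarrow> 'l \<Rightarrow> 'k fls"
  assumes char: "CHAR('k) \<noteq> 2"
    and lin: "\<And>v. functional (\<beta> v)"
    and anti: "\<And>v w. \<beta> w v = - \<beta> v w"
    and cocycle: "\<And>u v w. \<beta> (bracket u v) w + \<beta> (bracket v w) u + \<beta> (bracket w u) v = 0"
    and generic: "\<And>i. i < n - 1 \<Longrightarrow> (shift ^^ i) (\<lambda>v. \<beta> x v + fls_X * \<beta> y v) y = 0"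
    and odd: "\<And>i. i < n - 1 \<Longrightarrow> odd i \<Longrightarrow> (shift ^^ i) (\<beta> y) y = 0"
  shows "\<beta> v w = 0"
proof -
  have two: "(2::'k) \<noteq> 0"
  proof
    assume "(2::'k) = 0"
    then have "of_nat 2 = (0::'k)" by simp
    then have "CHAR('k) dvd 2" by (simp only: of_nat_eq_0_iff_char_dvd)
    then have "CHAR('k) \<le> 2" "CHAR('k) \<noteq> 0"
      by (cases "CHAR('k) = 0", auto dest: dvd_imp_le)+
    with char CHAR_not_1'[where 'a='k] show False by linarith
  qed
  have neg: "z = 0" if "z = - z" for z :: "'k fls"
  proof (rule fls_eqI)
    fix m
    have "fls_nth z m = - fls_nth z m" using that by (metis fls_uminus_nth)
    then have "2 * fls_nth z m = 0" by (simp add: eq_neg_iff_add_eq_0)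
    then show "fls_nth z m = fls_nth 0 m" using two by simp
  qed
  have self: "\<beta> v v = 0" for v using anti[of v v] by (rule neg)
  define \<theta> where "\<theta> = (\<lambda>v. \<beta> x v + fls_X * \<beta> y v)"
  have \<theta>: "\<theta> v = 0" for v
  proof (rule functional_eq_0)
    show "functional \<theta>"
      by (rule functionalI) (simp_all add: \<theta>_def functional_simps[OF lin] algebra_simps)
    show "\<theta> x + fls_X * \<theta> y = 0" by (simp add: \<theta>_def self anti[of x y])
    show "(shift ^^ i) \<theta> y = 0" if "i < n - 1" for i
      using generic[OF that] by (simp add: \<theta>_def)
  qed
  \<comment> \<open>The bracket with x + t y moves from one argument to the other at the cost of a sign, as \<theta> = 0.\<close>
  have moving: "shift (\<lambda>u. (shift ^^ m) (\<beta> u) w) v = - (shift ^^ Suc m) (\<beta> v) w" for m v w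
  proof (induction m arbitrary: v w)
    case 0
    have *: "\<beta> (bracket v z) w + \<beta> v (bracket w z) = \<beta> z (bracket w v)" for z
      using cocycle[of v z w] functional_simps(5)[OF lin, of v "bracket z w"]
        anti[of "bracket z w" v] anti[of "bracket w v" z] bracket_swap[of z w]
      by (simp add: algebra_simps)
    have "shift (\<lambda>u. \<beta> u w) v + shift (\<beta> v) w = \<theta> (bracket w v)"
      using *[of x] *[of y] by (simp add: shift_def \<theta>_def algebra_simps flip: distrib_left)
    then show ?case using \<theta> by (simp add: add_eq_0_iff2)
  next
    case (Suc m)
    have "shift (\<lambda>u. (shift ^^ Suc m) (\<beta> u) w) v =
        shift (\<lambda>u. (shift ^^ m) (\<beta> u) (bracket w x)) v +
        fls_X * shift (\<lambda>u. (shift ^^ m) (\<beta> u) (bracket w y)) v"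
      by (simp add: shift_def algebra_simps)
    also have "\<dots> = - (shift ^^ Suc (Suc m)) (\<beta> v) w"
      unfolding Suc.IH by (simp add: shift_def algebra_simps)
    finally show ?case .
  qed
  \<comment> \<open>For even m and v = w this is z = - z.\<close>
  have sym: "(shift ^^ m) (\<beta> w) v = - ((-1) ^ m) * (shift ^^ m) (\<beta> v) w" for m v w
  proof (induction m arbitrary: v w)
    case 0
    then show ?case using anti[of w v] by simp
  next
    case (Suc m)
    have "(shift ^^ m) (\<beta> w) = (\<lambda>u. - ((-1) ^ m) * (shift ^^ m) (\<beta> u) w)"
      using Suc.IH by (intro ext)
    then have "(shift ^^ Suc m) (\<beta> w) v = shift (\<lambda>u. - ((-1) ^ m) * (shift ^^ m) (\<beta> u) w) v"
      by (simp only: funpow.simps o_apply)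
    also have "\<dots> = - ((-1) ^ m) * shift (\<lambda>u. (shift ^^ m) (\<beta> u) w) v"
      by (simp add: shift_def algebra_simps)
    finally show ?case by (simp only: moving) simp
  qed
  have y: "\<beta> y w = 0" for w
  proof (rule functional_eq_0[OF lin])
    show "\<beta> y x + fls_X * \<beta> y y = 0"
      using \<theta>[of y] anti[of y x] by (simp add: \<theta>_def self)
    show "(shift ^^ i) (\<beta> y) y = 0" if "i < n - 1" for i
    proof (cases "odd i")
      case False
      then show ?thesis using sym[of i y y] by (intro neg) simp
    qed (use odd that in blast)
  qed
  have zero: "(shift ^^ i) (\<lambda>_. 0) = (\<lambda>_. 0)" for i
    by (induction i) (simp_all add: shift_def fun_eq_iff)
  show "\<beta> v w = 0"
  proof (rule functional_eq_0[OF lin])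
    show "\<beta> v x + fls_X * \<beta> v y = 0"
      using \<theta>[of v] anti[of v x] anti[of v y] by (simp add: \<theta>_def add_eq_0_iff2)
    have "\<beta> y = (\<lambda>_. 0)" using y by blast
    then show "(shift ^^ i) (\<beta> v) y = 0" for i
      using sym[of i y v] zero[of i] by simp
  qed
qed


section \<open>The derived algebra of a free presentation\<close>

lemma shift_sum:
  "(shift ^^ i) (\<lambda>v. \<Sum>s\<in>S. c s * g s v) v = (\<Sum>s\<in>S. c s * (shift ^^ i) (g s) v)"
proof (induction i arbitrary: v)
  case (Suc i)
  have "(shift ^^ i) (\<lambda>v. \<Sum>s\<in>S. c s * g s v) = (\<lambda>v. \<Sum>s\<in>S. c s * (shift ^^ i) (g s) v)"
    using Suc.IH by blast
  then show ?case
    by (simp add: shift_def[where v = v] sum_distrib_left sum.distrib algebra_simps)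
qed simp

lemma card_odd_lessThan: "card {i. i < m \<and> odd i} = m div 2"
proof (induction m)
  case (Suc m)
  have "{i. i < Suc m \<and> odd i} = (if odd m then Set.insert m else id) {i. i < m \<and> odd i}"
    by (auto simp: less_Suc_eq)
  with Suc show ?case by auto
qed simp

text \<open>
  The dimension of [F, F] modulo [R, F] is at most the number of conditions in \<open>cocycle_eq_0\<close>.
\<close>

lemma card_le_of_quot_independent:
  fixes p :: "('k, 'x) free_lie \<Rightarrow> 'l"
  assumes char: "CHAR('k) \<noteq> 2" and p: "free_presentation scale bracket p"
    and S: "finite S" "S \<subseteq> free.commutator UNIV UNIV" "free.quot_independent (schur_den p) S"
  shows "card S \<le> n - 1 + (n - 1) div 2"
proof (rule ccontr)
  assume large: "\<not> ?thesis"
  interpret p: Vector_Spaces.linear fscale scale p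
    using p by (simp add: free_presentation_def lie_hom_def)
  have p_br: "p (fbracket u w) = bracket (p u) (p w)" for u w
    using p by (simp add: free_presentation_def lie_hom_def)
  obtain \<sigma> where \<sigma>: "\<And>a. p (\<sigma> a) = a"
    using p unfolding free_presentation_def by (metis surjD)
  have "free.subspace (schur_den p)" by (simp add: schur_den_def free.commutator_def)
  then obtain \<phi> where lin: "\<And>s. Vector_Spaces.linear fscale (*) (\<phi> s)"
    and den: "\<And>s v. s \<in> S \<Longrightarrow> v \<in> schur_den p \<Longrightarrow> \<phi> s v = 0"
    and dual: "\<And>s r. s \<in> S \<Longrightarrow> r \<in> S \<Longrightarrow> \<phi> s r = (if r = s then 1 else 0)"
    using free.dual_functionals[of "schur_den p" S] S(3) by blast
  have \<phi>: "\<phi> s (u + v) = \<phi> s u + \<phi> s v" "\<phi> s (fscale a v) = a * \<phi> s v" "\<phi> s 0 = 0"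
    "\<phi> s (u - v) = \<phi> s u - \<phi> s v" "\<phi> s (- v) = - \<phi> s v" for s u v a
  proof -
    interpret f: Vector_Spaces.linear fscale "(*)" "\<phi> s" by (rule lin)
    show "\<phi> s (u + v) = \<phi> s u + \<phi> s v" "\<phi> s (fscale a v) = a * \<phi> s v" "\<phi> s 0 = 0"
      "\<phi> s (u - v) = \<phi> s u - \<phi> s v" "\<phi> s (- v) = - \<phi> s v"
      by (rule f.add f.scale f.zero f.diff f.neg)+
  qed
  have rel: "\<phi> s (fbracket u w) = 0" if "s \<in> S" "p u = 0" for s u w
    using that unfolding schur_den_def free.commutator_def relations_def
    by (intro den) (auto intro!: free.span_base simp: schur_den_def free.commutator_def relations_def)
  \<comment> \<open>As \<phi> s kills [R, F], the value at a bracket depends only on the images in L (fact \<open>key\<close>).\<close>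
  define \<psi> where "\<psi> s a b = \<phi> s (fbracket (\<sigma> a) (\<sigma> b))" for s a b
  have key: "\<phi> s (fbracket u w) = \<psi> s (p u) (p w)" if s: "s \<in> S" for s u w
  proof -
    have "\<phi> s (fbracket (u - \<sigma> (p u)) w) = 0"
      using s by (intro rel) (simp_all add: p.diff \<sigma>)
    moreover have "\<phi> s (fbracket (w - \<sigma> (p w)) (\<sigma> (p u))) = 0"
      using s by (intro rel) (simp_all add: p.diff \<sigma>)
    ultimately show ?thesis
      using free.bracket_swap[of "\<sigma> (p u)" w] free.bracket_swap[of "\<sigma> (p u)" "\<sigma> (p w)"]
      by (simp add: free.bracket_diff_left \<phi> \<psi>_def add_eq_0_iff2)
  qed
  have \<psi>_add: "\<psi> s a (b + b') = \<psi> s a b + \<psi> s a b'" if "s \<in> S" for s a b b'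
    using key[OF that, of "\<sigma> a" "\<sigma> b + \<sigma> b'"]
    by (simp add: p.add \<sigma> free.bracket_add_right \<phi> \<psi>_def)
  have \<psi>_scale: "\<psi> s a (scale d b) = d * \<psi> s a b" if "s \<in> S" for s a b d
    using key[OF that, of "\<sigma> a" "fscale d (\<sigma> b)"]
    by (simp add: p.scale \<sigma> free.bracket_scale_right \<phi> \<psi>_def)
  have \<psi>_anti: "\<psi> s b a = - \<psi> s a b" for s a b
    using free.bracket_swap[of "\<sigma> b" "\<sigma> a"] by (simp add: \<psi>_def \<phi>)
  have \<psi>_cocycle: "\<psi> s (bracket a b) d + \<psi> s (bracket b d) a + \<psi> s (bracket d a) b = 0"
    if "s \<in> S" for s a b d
  proof -
    have 1: "\<psi> s (bracket a b) d = - \<phi> s (fbracket (\<sigma> d) (fbracket (\<sigma> a) (\<sigma> b)))" for a b d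
      using key[OF that, of "fbracket (\<sigma> a) (\<sigma> b)" "\<sigma> d"]
        free.bracket_swap[of "fbracket (\<sigma> a) (\<sigma> b)" "\<sigma> d"]
      by (simp add: p_br \<sigma> \<phi>)
    have "\<phi> s (fbracket (\<sigma> a) (fbracket (\<sigma> b) (\<sigma> d)) + fbracket (\<sigma> b) (fbracket (\<sigma> d) (\<sigma> a))
        + fbracket (\<sigma> d) (fbracket (\<sigma> a) (\<sigma> b))) = 0"
      by (simp only: free.jacobi \<phi>)
    then show ?thesis unfolding 1 \<phi> by (simp add: algebra_simps) (simp add: neg_eq_iff_add_eq_0)
  qed
  \<comment> \<open>The left summand indexes the conditions \<open>generic\<close>, the right one the conditions \<open>odd\<close>.\<close>
  define J :: "(nat + nat) set" where "J = {..<n - 1} <+> {i. i < n - 1 \<and> odd i}"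
  have J: "finite J" "card J = n - 1 + (n - 1) div 2"
    by (simp_all add: J_def card_Plus card_odd_lessThan)
  define A where "A s j = (case j of
      Inl i \<Rightarrow> (shift ^^ i) (\<lambda>v. fls_const (\<psi> s x v) + fls_X * fls_const (\<psi> s y v)) y
    | Inr i \<Rightarrow> (shift ^^ i) (\<lambda>v. fls_const (\<psi> s y v)) y)" for s j
  obtain c where c: "\<exists>s\<in>S. c s \<noteq> 0" "\<forall>j\<in>J. (\<Sum>s\<in>S. c s * A s j) = 0"
    using nontrivial_kernel[of J S A] J S(1) large by auto
  define \<beta> where "\<beta> a b = (\<Sum>s\<in>S. c s * fls_const (\<psi> s a b))" for a b
  have \<beta>: "\<beta> a b = 0" for a b
  proof (rule cocycle_eq_0[OF char])
    show "functional (\<beta> a)" for a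
      by (rule functionalI)
        (simp_all add: \<beta>_def \<psi>_add \<psi>_scale algebra_simps sum.distrib sum_distrib_left
          fls_plus_const[symmetric] fls_const_mult_const[symmetric] del: fls_const_mult_const)
    show "\<beta> b a = - \<beta> a b" for a b
      unfolding \<beta>_def by (simp add: \<psi>_anti[of _ b a] sum_negf)
    show "\<beta> (bracket a b) d + \<beta> (bracket b d) a + \<beta> (bracket d a) b = 0" for a b d
    proof -
      have "\<beta> (bracket a b) d + \<beta> (bracket b d) a + \<beta> (bracket d a) b =
          (\<Sum>s\<in>S. c s * fls_const (\<psi> s (bracket a b) d + \<psi> s (bracket b d) a + \<psi> s (bracket d a) b))"
        by (simp add: \<beta>_def sum.distrib algebra_simps fls_plus_const[symmetric])
      also have "\<dots> = 0" by (intro sum.neutral ballI) (simp add: \<psi>_cocycle)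
      finally show ?thesis .
    qed
    show "(shift ^^ i) (\<lambda>v. \<beta> x v + fls_X * \<beta> y v) y = 0" if "i < n - 1" for i
    proof -
      have "(\<lambda>v. \<beta> x v + fls_X * \<beta> y v) =
          (\<lambda>v. \<Sum>s\<in>S. c s * (fls_const (\<psi> s x v) + fls_X * fls_const (\<psi> s y v)))"
        by (simp add: \<beta>_def sum.distrib sum_distrib_left algebra_simps)
      moreover have "Inl i \<in> J" using that by (auto simp: J_def)
      ultimately show ?thesis
        using c(2)[rule_format, of "Inl i"] by (simp add: shift_sum A_def)
    qed
    show "(shift ^^ i) (\<beta> y) y = 0" if "i < n - 1" "odd i" for i
    proof -
      have "\<beta> y = (\<lambda>v. \<Sum>s\<in>S. c s * fls_const (\<psi> s y v))" by (simp add: \<beta>_def fun_eq_iff)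
      moreover have "Inr i \<in> J" using that by (auto simp: J_def)
      ultimately show ?thesis
        using c(2)[rule_format, of "Inr i"] by (simp add: shift_sum A_def)
    qed
  qed
  obtain s0 m where s0: "s0 \<in> S" "fls_nth (c s0) m \<noteq> 0"
    using c(1) by (metis fls_eqI fls_zero_nth)
  \<comment> \<open>The m-th Laurent coefficient of the dependency has constants as coefficients.\<close>
  define G where "G v = (\<Sum>s\<in>S. fls_nth (c s) m * \<phi> s v)" for v
  have "G s0 = 0"
  proof -
    have "s0 \<in> free.span {fbracket a b |a b. True}"
      using S(2) s0(1) by (auto simp: free.commutator_def)
    then show ?thesis
    proof (induction rule: free.span_induct_alt)
      case base
      then show ?case by (simp add: G_def \<phi>)
    next
      case (step d v w)
      then obtain a b where v: "v = fbracket a b" by blast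
      have "G v = fls_nth (\<beta> (p a) (p b)) m"
        unfolding G_def \<beta>_def v fls_nth_sum
        by (intro sum.cong) (simp_all add: key)
      then have "G v = 0" by (simp add: \<beta>)
      moreover have "G (fscale d v + w) = d * G v + G w"
        by (simp add: G_def \<phi> sum.distrib sum_distrib_left algebra_simps)
      ultimately show ?case using step by simp
    qed
  qed
  moreover have "G s0 = fls_nth (c s0) m"
  proof -
    have "G s0 = (\<Sum>s\<in>S. if s = s0 then fls_nth (c s) m else 0)"
      unfolding G_def using s0(1) by (intro sum.cong) (auto simp: dual)
    then show ?thesis using S(1) s0(1) by simp
  qed
  ultimately show False using s0(2) by simp
qed

end

section \<open>The Schur multiplier\<close>

text \<open>
  The map p sends [F, F] onto [L, L] and kills both the multiplier and [R, F]. So lifts of a basis of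
  [L, L] stay independent of representatives of the multiplier, and the two dimensions add up.
\<close>

lemma (in lie_algebra) extend_by_lifts:
  fixes p :: "('k, 'x) free_lie \<Rightarrow> 'l"
  assumes p: "free_presentation scale bracket p"
    and C: "finite C" "C \<subseteq> schur_num p" "free.quot_independent (schur_den p) C"
    and B: "finite B" "B \<subseteq> lower_central 2" "local.independent B"
  obtains S where "finite S" "S \<subseteq> free.commutator UNIV UNIV"
    "free.quot_independent (schur_den p) S" "card S = card C + card B"
proof -
  interpret p: Vector_Spaces.linear fscale scale p
    using p by (simp add: free_presentation_def lie_hom_def)
  have p_br: "p (fbracket u w) = bracket (p u) (p w)" for u w
    using p by (simp add: free_presentation_def lie_hom_def)
  have surj: "\<exists>u. p u = a" for a
    using p unfolding free_presentation_def by (metis surjD)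
  have image: "p ` free.commutator UNIV UNIV = lower_central 2"
  proof -
    have "p ` {fbracket a b |a b. True} = {bracket v w |v w. True}"
    proof
      show "{bracket v w |v w. True} \<subseteq> p ` {fbracket a b |a b. True}"
      proof clarify
        fix v w
        obtain a b where "p a = v" "p b = w" using surj by blast
        then have "bracket v w = p (fbracket a b)" by (simp add: p_br)
        then show "bracket v w \<in> p ` {fbracket a b |a b. True}" by blast
      qed
      show "p ` {fbracket a b |a b. True} \<subseteq> {bracket v w |v w. True}"
        using p_br by blast
    qed
    then show ?thesis
      using p.span_image[of "{fbracket a b |a b. True}"]
      by (simp add: free.commutator_def lower_central_2)
  qed
  have "\<forall>b\<in>B. \<exists>u. u \<in> free.commutator UNIV UNIV \<and> p u = b"
  proof
    fix b
    assume "b \<in> B"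
    then have "b \<in> p ` free.commutator UNIV UNIV" using B(2) unfolding image by (rule rev_subsetD)
    then show "\<exists>u. u \<in> free.commutator UNIV UNIV \<and> p u = b" by (elim imageE) auto
  qed
  from bchoice[OF this] obtain \<tau> where
    \<tau>: "\<And>b. b \<in> B \<Longrightarrow> \<tau> b \<in> free.commutator UNIV UNIV" "\<And>b. b \<in> B \<Longrightarrow> p (\<tau> b) = b"
    by blast
  have inj: "inj_on \<tau> B" using \<tau>(2) by (metis inj_onI)
  have pC: "p v = 0" if "v \<in> C" for v
    using that C(2) by (auto simp: schur_num_def relations_def)
  have disj: "C \<inter> \<tau> ` B = {}"
    using \<tau>(2) pC B(3) dependent_zero by fastforce
  have den: "p v = 0" if "v \<in> schur_den p" for v
    using that unfolding schur_den_def free.commutator_def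
    by (rule p.eq_0_on_span[rotated]) (auto simp: relations_def p_br)
  show ?thesis
  proof (rule that[of "C \<union> \<tau> ` B"])
    show "finite (C \<union> \<tau> ` B)" using C(1) B(1) by simp
    show "C \<union> \<tau> ` B \<subseteq> free.commutator UNIV UNIV" using C(2) \<tau>(1) by (auto simp: schur_num_def)
    show "card (C \<union> \<tau> ` B) = card C + card B"
      using C(1) B(1) disj inj by (simp add: card_Un_disjoint card_image)
    show "free.quot_independent (schur_den p) (C \<union> \<tau> ` B)"
      unfolding free.quot_independent_def
    proof (intro allI impI)
      fix T u
      assume T: "finite T" "T \<subseteq> C \<union> \<tau> ` B" and den_T: "(\<Sum>v\<in>T. fscale (u v) v) \<in> schur_den p"
      define D where "D = {b \<in> B. \<tau> b \<in> T}"
      have TD: "T = (T \<inter> C) \<union> \<tau> ` D" "(T \<inter> C) \<inter> \<tau> ` D = {}" "finite D" "D \<subseteq> B"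
        using T disj B(1) by (auto simp: D_def)
      have split: "(\<Sum>v\<in>T. f v) = (\<Sum>v\<in>T \<inter> C. f v) + (\<Sum>b\<in>D. f (\<tau> b))"
        for f :: "_ \<Rightarrow> 'z::comm_monoid_add"
      proof -
        have "(\<Sum>v\<in>T. f v) = (\<Sum>v\<in>T \<inter> C. f v) + (\<Sum>v\<in>\<tau> ` D. f v)"
          using T(1) TD(2,3) by (subst TD(1), subst sum.union_disjoint) auto
        then show ?thesis
          using inj_on_subset[OF inj TD(4)] by (simp add: sum.reindex)
      qed
      have "(\<Sum>v\<in>T. scale (u v) (p v)) = p (\<Sum>v\<in>T. fscale (u v) v)"
        by (simp add: p.sum p.scale)
      also have "\<dots> = 0" using den_T by (rule den)
      finally have "(\<Sum>b\<in>D. scale (u (\<tau> b)) b) = 0"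
        using TD(4) pC by (simp add: split \<tau>(2) subset_iff)
      then have D0: "u (\<tau> b) = 0" if "b \<in> D" for b
        using independentD[OF B(3) TD(3,4), of "\<lambda>b. u (\<tau> b)"] that by blast
      then have "(\<Sum>v\<in>T \<inter> C. fscale (u v) v) \<in> schur_den p"
        using den_T by (simp add: split)
      then have "\<forall>v\<in>T \<inter> C. u v = 0"
        using C(3)[unfolded free.quot_independent_def, rule_format, of "T \<inter> C" u] T(1) by blast
      with D0 show "\<forall>v\<in>T. u v = 0" using TD(1) by blast
    qed
  qed
qed

theorem mainTheorem1:
  fixes scale :: "'k::field \<Rightarrow> 'l::ab_group_add \<Rightarrow> 'l"
    and bracket :: "'l \<Rightarrow> 'l \<Rightarrow> 'l"
    and n :: nat
    and p :: "('k, 'x) free_lie \<Rightarrow> 'l"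
  assumes "CHAR('k) \<noteq> 2"
    and "lie_algebra scale bracket"
    and "lie_algebra.maximal_class scale bracket n"
    and "free_presentation scale bracket p"
  shows "fin_dim_schur p
    \<and> (even n \<longrightarrow> real (dim_schur p) \<le> real n / 2)
    \<and> (odd n \<longrightarrow> int (dim_schur p) \<le> \<lceil>(real n + 1) / 2\<rceil>)"
proof -
  interpret lie_algebra scale bracket by fact
  note max = maximal_class_dims[OF assms(3)]
  obtain x y where "maximal_class_frame scale bracket n x y" using max(3) by blast
  then interpret frame: maximal_class_frame scale bracket n x y .
  obtain Basis where "finite_dimensional_vector_space scale Basis"
    using assms(3) by (auto simp: maximal_class_def has_dimension_def)
  then interpret fd: finite_dimensional_vector_space scale Basis .
  obtain B where B: "B \<subseteq> lower_central 2" "local.independent B" "card B = local.dim (lower_central 2)"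
    by (rule basis_exists)
  have cardB: "card B = n - 2" using B(3) max(1,2) by simp
  have "finite B" using B(2) by (rule fd.finiteI_independent)
  have "card C \<le> (n + 1) div 2"
    if C: "finite C" "C \<subseteq> schur_num p" "free.quot_independent (schur_den p) C" for C
  proof -
    obtain S where S: "finite S" "S \<subseteq> free.commutator UNIV UNIV"
      "free.quot_independent (schur_den p) S" "card S = card C + card B"
      using extend_by_lifts[OF assms(4) C \<open>finite B\<close> B(1,2)] .
    have "card C + (n - 2) \<le> n - 1 + (n - 1) div 2"
      using frame.card_le_of_quot_independent[OF assms(1,4) S(1-3)] S(4) cardB by simp
    then show ?thesis using max(1) by linarith
  qed
  note bound = free.quot_dim_le[OF _ _ this]
  have "free.subspace (schur_den p)" by (simp add: schur_den_def free.commutator_def)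
  moreover have "free.subspace (schur_num p)"
  proof -
    interpret p: Vector_Spaces.linear fscale scale p
      using assms(4) by (simp add: free_presentation_def lie_hom_def)
    show ?thesis
      unfolding schur_num_def relations_def free.commutator_def
      by (intro free.subspace_inter p.subspace_kernel free.subspace_span)
  qed
  ultimately have "fin_dim_schur p" and le: "dim_schur p \<le> (n + 1) div 2"
    using bound by (simp_all add: fin_dim_schur_def dim_schur_def)
  moreover have "real (dim_schur p) \<le> real n / 2" if "even n"
    using le that by (auto elim!: evenE)
  moreover have "int (dim_schur p) \<le> \<lceil>(real n + 1) / 2\<rceil>" if "odd n"
  proof -
    have "real (dim_schur p) \<le> (real n + 1) / 2" using le that by (auto elim!: oddE)
    from ceiling_mono[OF this] show ?thesis by simp
  qed
  ultimately show ?thesis by blast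
qed

end
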